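(* Let $H=\{z\in\mathbb{C}:\mathrm{Im}\,z>0\}$. Let $f$ be an injective holomorphic function on $H$ which extends as a $C^1$ function to the closed half-plane $\overline{H}=\{\mathrm{Im}\,z\geq 0\}$, and let $c>0$. Then: (1) if $|f'|\leq c$ on $\mathbb{R}$, then $|f'|\leq c$ in $H$; (2) if $|f'|\geq c$ on $\mathbb{R}$, then $|f'|\geq c$ in $H$; (3) if $|f'|$ is constant on $\mathbb{R}$, then $f'$ is constant in $H$. *)

theory Defs
  imports "HOL-Analysis.Analysis"
begin

definition upper_half_plane :: "complex set" where
  "upper_half_plane = {z. Im z > 0}"

definition closed_upper_half_plane :: "complex set" where
  "closed_upper_half_plane = {z. Im z \<ge> 0}"

definition C1_on_closed_half_plane :: "(complex \<Rightarrow> complex) \<Rightarrow> (complex \<Rightarrow> (complex \<Rightarrow>\<^sub>L complex)) \<Rightarrow> bool" where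
  "C1_on_closed_half_plane f D \<longleftrightarrow>
     (\<forall>z\<in>closed_upper_half_plane.
        (f has_derivative blinfun_apply (D z)) (at z within closed_upper_half_plane))
     \<and> continuous_on closed_upper_half_plane D"

end

(*
  The second-derivative bound |g''(0)| \<le> K |g'(0)| for injective g on the disc, rescaled to discs
  in the half-plane, makes log f' Lipschitz for the hyperbolic metric; hence f' and 1/f'
  are bounded by C ((1 + |z|)\<^sup>2 / Im z)^N. A polynomial factor on half-discs removes
  the singularity at the real axis, and the Phragmen-Lindelof principle then applies to f'
  and to 1/f'.
*)
theory Submission
  imports Defs "HOL-Complex_Analysis.Complex_Analysis" "HOL-Real_Asymp.Real_Asymp"
begin

section \<open>Omitted values and second derivatives of univalent functions on the disc\<close>

text \<open>If the image contained the closed disc of radius \<open>2 * norm (deriv g 0)\<close>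
  about \<open>g 0\<close>, the inverse of \<open>g\<close> would map that disc into the unit disc.
  Cauchy's inequality would then bound its derivative at \<open>g 0\<close> by half of the true
  modulus \<open>1 / norm (deriv g 0)\<close>.\<close>

lemma univalent_omits_nearby_value:
  assumes hol: "g holomorphic_on ball 0 1" and inj: "inj_on g (ball 0 1)"
  obtains w where "w \<notin> g ` ball 0 1" "norm (w - g 0) \<le> 2 * norm (deriv g 0)"
proof -
  let ?d = "norm (deriv g 0)"
  have d: "?d > 0"
    using holomorphic_injective_imp_regular[OF hol open_ball inj] by simp
  have "\<not> cball (g 0) (2 * ?d) \<subseteq> g ` ball 0 1"
  proof
    assume sub: "cball (g 0) (2 * ?d) \<subseteq> g ` ball 0 1"
    obtain k where k: "k holomorphic_on g ` ball 0 1"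
      "\<And>z. z \<in> ball 0 1 \<Longrightarrow> deriv g z * deriv k (g z) = 1"
      "\<And>z. z \<in> ball 0 1 \<Longrightarrow> k (g z) = z"
      using holomorphic_has_inverse[OF hol open_ball inj] by blast
    have holk: "k holomorphic_on cball (g 0) (2 * ?d)"
      using k(1) sub holomorphic_on_subset by blast
    have "norm ((deriv ^^ 1) k (g 0)) \<le> fact 1 * 1 / (2 * ?d) ^ 1"
    proof (rule Cauchy_inequality)
      show "k holomorphic_on ball (g 0) (2 * ?d)"
        using holk ball_subset_cball holomorphic_on_subset by blast
      show "continuous_on (cball (g 0) (2 * ?d)) k"
        using holk by (rule holomorphic_on_imp_continuous_on)
      show "norm (k x) \<le> 1" if "norm (g 0 - x) = 2 * ?d" for x
      proof -
        have "x \<in> g ` ball 0 1" using sub that by (auto simp: dist_norm subset_iff)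
        then show ?thesis using k(3) by auto
      qed
    qed (use d in auto)
    moreover have "?d * norm (deriv k (g 0)) = 1"
      using k(2)[of 0] by (simp flip: norm_mult)
    ultimately show False using d by (simp add: field_simps)
  qed
  then show ?thesis using that by (auto simp: subset_iff dist_norm norm_minus_commute)
qed

text \<open>With \<open>w\<close> an omitted value, a square root \<open>h\<close> of \<open>(w - g)/(w - g 0)\<close> never vanishes and,
  as \<open>g\<close> is injective, never takes the value \<open>- h 0\<close>; so Schottky's theorem applies to
  \<open>- h / h 0\<close>.\<close>

lemma univalent_second_derivative_bound:
  obtains K :: real where
    "\<And>g. g holomorphic_on ball 0 1 \<Longrightarrow> inj_on g (ball 0 1) \<Longrightarrow>
       norm ((deriv ^^ 2) g 0) \<le> K * norm (deriv g 0)"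
proof -
  \<comment> \<open>The constant of Schottky's theorem for a function of modulus at most 1 at the
    centre, estimated on the disc of radius 1/2.\<close>
  define M :: real where "M = exp (pi * exp (pi * (2 + 2 * 1 + 12 * (1/2) / (1 - 1/2))))"
  have M: "M > 0" by (simp add: M_def)
  show ?thesis
  \<comment> \<open>Cauchy's estimate for the second derivative on the disc of radius 1/4, where
    \<open>g\<close> stays within \<open>3 * M^2 * norm (deriv g 0)\<close> of the omitted
    value.\<close>
  proof (rule that[of "fact 2 * (3 * M\<^sup>2) / (1/4)^2"])
    fix g :: "complex \<Rightarrow> complex"
    assume hol: "g holomorphic_on ball 0 1" and inj: "inj_on g (ball 0 1)"
    let ?d = "norm (deriv g 0)"
    have d: "?d > 0"
      using holomorphic_injective_imp_regular[OF hol open_ball inj] by simp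
    obtain w where w: "w \<notin> g ` ball 0 1" "norm (w - g 0) \<le> 2 * ?d"
      using univalent_omits_nearby_value[OF hol inj] .
    have wg: "w - g z \<noteq> 0" if "z \<in> ball 0 1" for z
      using w(1) that by auto
    have w0: "w - g 0 \<noteq> 0" using wg[of 0] by simp
    define p where "p z = (w - g z) / (w - g 0)" for z
    have "p holomorphic_on ball 0 1"
      unfolding p_def by (intro holomorphic_intros hol) (use w0 in auto)
    moreover have "contractible (ball (0::complex) 1)"
      by (simp add: convex_imp_contractible)
    moreover have "p z \<noteq> 0" if "z \<in> ball 0 1" for z
      using wg[OF that] w0 by (simp add: p_def)
    ultimately obtain h where h: "h holomorphic_on ball 0 1"
      "\<And>z. z \<in> ball 0 1 \<Longrightarrow> p z = (h z)\<^sup>2"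
      using contractible_imp_holomorphic_sqrt[of p "ball 0 1"] by metis
    have h0: "(h 0)\<^sup>2 = 1" using h(2)[of 0] w0 by (simp add: p_def)
    then have h0': "h 0 \<noteq> 0" by auto
    \<comment> \<open>Schottky's theorem asks for holomorphy on the closed unit disc, hence the
      argument \<open>z / 2\<close>. The estimate of \<open>q\<close> for
      \<open>norm z \<le> 1/2\<close> therefore controls \<open>h\<close> only on the disc of radius
      1/4.\<close>
    define q where "q z = - h (z / 2) / h 0" for z
    have q: "norm (q z) \<le> M" if "norm z \<le> 1/2" for z
      unfolding M_def
    proof (rule Schottky[of q 1 "1/2" z])
      show "q holomorphic_on cball 0 1"
        unfolding q_def
        by (intro holomorphic_intros holomorphic_on_compose_gen[of "\<lambda>z. z / 2" _ h "ball 0 1", unfolded o_def])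
           (use h(1) h0' in auto)
      show "norm (q 0) \<le> 1" using h0' by (simp add: q_def norm_divide)
      fix x :: complex assume "x \<in> cball 0 1"
      then have x: "x / 2 \<in> ball 0 1" by (auto simp: norm_divide)
      have "q x \<noteq> 0" using h(2)[OF x] wg[OF x] w0 h0' by (auto simp: q_def p_def)
      moreover have "q x \<noteq> 1"
      proof
        assume "q x = 1"
        then have "- h (x / 2) = h 0" using h0' by (simp add: q_def field_simps)
        then have eq: "h (x / 2) = - h 0" by (metis minus_minus)
        then have "p (x / 2) = 1" using h(2)[OF x] h0 by simp
        then have "g (x / 2) = g 0" using w0 by (simp add: p_def)
        then have "x / 2 = 0" using inj_onD[OF inj _ x, of 0] by simp
        then show False using eq h0' by simp
      qed
      ultimately show "\<not> (q x = 0 \<or> q x = 1)" by simp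
    qed (use that in auto)
    \<comment> \<open>The argument yields the factor 2; it is enlarged to 3 to make the inequality
      strict, since the Cauchy estimate below wants values in an open ball.\<close>
    have bd: "norm (g z - w) < 3 * ?d * M\<^sup>2" if "norm z < 1/4" for z
    proof -
      have z: "z \<in> ball 0 1" using that by simp
      have "norm (2 * z) \<le> 1/2" using that by (simp add: norm_mult)
      from q[OF this] have "norm (h z) \<le> M"
        using h0 by (auto simp: q_def norm_divide power2_eq_1_iff)
      then have "norm (p z) \<le> M\<^sup>2"
        by (simp add: h(2)[OF z] norm_power power_mono)
      then have "norm (w - g z) \<le> M\<^sup>2 * norm (w - g 0)"
        using w0 by (simp add: p_def norm_divide divide_le_eq)
      also have "\<dots> \<le> M\<^sup>2 * (2 * ?d)"
        using w(2) by (intro mult_left_mono) auto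
      also have "\<dots> < 3 * ?d * M\<^sup>2" using d M by simp
      finally show ?thesis by (simp add: norm_minus_commute)
    qed
    have "norm ((deriv ^^ 2) g 0) \<le> fact 2 * (3 * ?d * M\<^sup>2) / (1/4)^2"
    proof (rule Cauchy_higher_deriv_bound)
      show "g holomorphic_on ball 0 (1/4)"
        using hol by (rule holomorphic_on_subset) auto
      show "continuous_on (cball 0 (1/4)) g"
        by (rule holomorphic_on_imp_continuous_on, rule holomorphic_on_subset[OF hol]) auto
      show "g z \<in> ball w (3 * ?d * M\<^sup>2)" if "z \<in> ball 0 (1/4)" for z
        using bd[of z] that by (simp add: dist_norm norm_minus_commute)
    qed auto
    then show "norm ((deriv ^^ 2) g 0) \<le> fact 2 * (3 * M\<^sup>2) / (1/4)^2 * ?d"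
      by (simp add: mult_ac)
  qed
qed

section \<open>Growth in the half-plane from hyperbolic Lipschitz bounds\<close>

text \<open>With the height written as \<open>exp u\<close>, the chain rule contributes a factor of
  modulus equal to the height, which cancels \<open>Im z\<close> in the bound. So \<open>L\<close>
  is \<open>K\<close>-Lipschitz in the logarithm of the height.\<close>

lemma vertical_log_bound:
  fixes L :: "complex \<Rightarrow> complex"
  assumes hol: "L holomorphic_on {z. Im z > 0}"
    and bd: "\<And>z. Im z > 0 \<Longrightarrow> norm (deriv L z) \<le> K / Im z"
    and ab: "a > 0" "b > 0"
  shows "norm (L (Complex x a) - L (Complex x b)) \<le> K * \<bar>ln a - ln b\<bar>"
proof -
  define \<psi> where "\<psi> u = L (of_real x + \<i> * exp u)" for u
  have im: "Im (of_real x + \<i> * exp u) = exp (Re u)" if "u \<in> \<real>" for u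
    using that by (auto simp: Re_exp elim!: Reals_cases)
  have "norm (\<psi> (of_real (ln a)) - \<psi> (of_real (ln b))) \<le> K * norm (complex_of_real (ln a) - of_real (ln b))"
  proof (rule field_differentiable_bound[of "\<real>"])
    show "convex (\<real> :: complex set)"
      by (auto simp: convex_def scaleR_conv_of_real)
    fix u :: complex assume u: "u \<in> \<real>"
    let ?v = "of_real x + \<i> * exp u"
    have "(L has_field_derivative deriv L ?v) (at ?v)"
      using im[OF u] by (intro holomorphic_derivI[OF hol]) (auto simp: open_halfspace_Im_gt)
    moreover have "((\<lambda>u. of_real x + \<i> * exp u) has_field_derivative \<i> * exp u) (at u within \<real>)"
      by (auto intro!: derivative_eq_intros)
    ultimately show "(\<psi> has_field_derivative deriv L ?v * (\<i> * exp u)) (at u within \<real>)"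
      unfolding \<psi>_def by (rule DERIV_chain2)
    have "norm (deriv L ?v) \<le> K / exp (Re u)"
      using bd[of ?v] im[OF u] by simp
    then show "norm (deriv L ?v * (\<i> * exp u)) \<le> K"
      by (simp add: norm_mult field_simps)
  qed auto
  moreover have "of_real x + \<i> * exp (of_real (ln t)) = Complex x t" if "t > 0" for t
    using that by (simp add: complex_eq_iff Re_exp Im_exp exp_of_real)
  ultimately show ?thesis
    using ab by (simp add: \<psi>_def flip: of_real_diff)
qed

lemma horizontal_bound:
  fixes L :: "complex \<Rightarrow> complex"
  assumes hol: "L holomorphic_on {z. Im z > 0}"
    and bd: "\<And>z. Im z > 0 \<Longrightarrow> norm (deriv L z) \<le> K / Im z"
    and a: "a > 0"
  shows "norm (L (Complex x a) - L (Complex y a)) \<le> K / a * \<bar>x - y\<bar>"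
proof -
  have "norm (L (Complex x a) - L (Complex y a)) \<le> K / a * norm (Complex x a - Complex y a)"
  proof (rule field_differentiable_bound[of "{z. Im z = a}"])
    show "convex {z. Im z = a}"
      by (auto simp: convex_def simp flip: distrib_right)
    fix z assume "z \<in> {z. Im z = a}"
    then have z: "Im z = a" by simp
    show "(L has_field_derivative deriv L z) (at z within {z. Im z = a})"
      using z a by (intro holomorphic_derivI[OF hol open_halfspace_Im_gt]) simp
    show "norm (deriv L z) \<le> K / a" using bd[of z] z a by simp
  qed auto
  also have "norm (Complex x a - Complex y a) = \<bar>x - y\<bar>"
    by (simp add: cmod_def)
  finally show ?thesis .
qed

text \<open>The path from \<open>\<i>\<close> to \<open>z\<close> goes up to height \<open>1 + |z|\<close>, then across, then down.\<close>

lemma half_plane_log_growth: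
  fixes L :: "complex \<Rightarrow> complex"
  assumes hol: "L holomorphic_on {z. Im z > 0}"
    and bd: "\<And>z. Im z > 0 \<Longrightarrow> norm (deriv L z) \<le> K / Im z"
    and z: "Im z > 0"
  shows "norm (L z - L \<i>) \<le> K * (1 + ln ((1 + norm z)\<^sup>2 / Im z))"
proof -
  define r where "r = 1 + norm z"
  have r: "r \<ge> 1" "Im z \<le> r" "\<bar>Re z\<bar> \<le> r"
    using abs_Im_le_cmod[of z] abs_Re_le_cmod[of z] by (auto simp: r_def)
  have K: "K \<ge> 0" using order_trans[OF norm_ge_zero bd[of \<i>]] by simp
  have "norm (L z - L (Complex (Re z) r)) \<le> K * (ln r - ln (Im z))"
    using vertical_log_bound[OF hol bd, of "Im z" r "Re z"] r z by simp
  \<comment> \<open>The height \<open>r\<close> is at least the horizontal distance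
    \<open>\<bar>Re z\<bar>\<close>, so crossing costs no more than the constant
    \<open>K\<close>.\<close>
  moreover have "norm (L (Complex (Re z) r) - L (Complex 0 r)) \<le> K"
  proof -
    have "K / r * \<bar>Re z - 0\<bar> \<le> K / r * r"
      using r K by (intro mult_left_mono) auto
    then show ?thesis
      using horizontal_bound[OF hol bd, of r "Re z" 0] r by simp
  qed
  moreover have "norm (L (Complex 0 r) - L \<i>) \<le> K * ln r"
    using vertical_log_bound[OF hol bd, of r 1 0] r by (simp add: imaginary_unit.code)
  moreover have "norm (L z - L \<i>) \<le> norm (L z - L (Complex (Re z) r)) +
      norm (L (Complex (Re z) r) - L (Complex 0 r)) + norm (L (Complex 0 r) - L \<i>)"
    by norm
  moreover have "ln (r\<^sup>2 / Im z) = 2 * ln r - ln (Im z)"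
    using r z by (simp add: ln_div ln_realpow)
  then have "K * (1 + ln (r\<^sup>2 / Im z)) = K * (ln r - ln (Im z)) + K + K * ln r"
    by (simp only:) (simp add: algebra_simps)
  ultimately show ?thesis unfolding r_def by linarith
qed

text \<open>A logarithm \<open>L\<close> of \<open>deriv f\<close> has derivative
  \<open>f'' / f'\<close>, which the disc estimate bounds by a multiple of \<open>1 / Im z\<close>.
  Integration makes \<open>Re L\<close> at most logarithmic, and exponentiation turns this into a
  power.\<close>

lemma univalent_half_plane_derivative_growth:
  assumes hol: "f holomorphic_on {z. Im z > 0}" and inj: "inj_on f {z. Im z > 0}"
  obtains C :: real and N :: nat where
    "\<And>z. Im z > 0 \<Longrightarrow> norm (deriv f z) \<le> C * ((1 + norm z)\<^sup>2 / Im z) ^ N"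
    "\<And>z. Im z > 0 \<Longrightarrow> norm (inverse (deriv f z)) \<le> C * ((1 + norm z)\<^sup>2 / Im z) ^ N"
proof -
  let ?H = "{z. Im z > 0}"
  obtain K0 :: real where K0: "\<And>g. g holomorphic_on ball 0 1 \<Longrightarrow> inj_on g (ball 0 1) \<Longrightarrow>
       norm ((deriv ^^ 2) g 0) \<le> K0 * norm (deriv g 0)"
    using univalent_second_derivative_bound by blast
  \<comment> \<open>An integer exponent is chosen so that the \<open>N\<close>-th power of a
    polynomial can later cancel the singularity without branches.\<close>
  obtain N :: nat where N: "K0 \<le> real N" using real_arch_simple by blast
  have nz: "deriv f z \<noteq> 0" if "Im z > 0" for z
    using holomorphic_injective_imp_regular[OF hol open_halfspace_Im_gt inj] that by simp
  have holf': "deriv f holomorphic_on ?H"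
    using hol open_halfspace_Im_gt by (rule holomorphic_deriv)
  \<comment> \<open>The disc of radius \<open>Im z\<close> about \<open>z\<close> lies in the
    half-plane, so \<open>f (y * w + z)\<close> is univalent for \<open>w\<close> in the unit disc.
    Its first and second derivatives at 0 carry the factors \<open>y\<close> and \<open>y^2\<close>,
    and their quotient produces \<open>1 / Im z\<close>.\<close>
  have pre_schwarzian: "norm (deriv (deriv f) z) \<le> N / Im z * norm (deriv f z)" if z: "Im z > 0" for z
  proof -
    define y where "y = complex_of_real (Im z)"
    have sub: "y * w + z \<in> ?H" if "w \<in> ball 0 1" for w
    proof -
      have "Im z * \<bar>Im w\<bar> < Im z * 1"
        using that abs_Im_le_cmod[of w] z by (intro mult_strict_left_mono) auto
      then have "\<bar>Im z * Im w\<bar> < Im z" using z by (simp add: abs_mult)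
      then show ?thesis by (simp add: y_def)
    qed
    let ?g = "\<lambda>w. f (y * w + z)"
    have "?g holomorphic_on ball 0 1"
      by (intro holomorphic_on_compose_gen[of "\<lambda>w. y * w + z" _ f ?H, unfolded o_def]
          holomorphic_intros hol) (use sub in blast)
    moreover have "inj_on ?g (ball 0 1)"
    proof (rule inj_onI)
      fix u v :: complex assume "u \<in> ball 0 1" "v \<in> ball 0 1" "?g u = ?g v"
      then have "y * u + z = y * v + z" using inj_onD[OF inj] sub by blast
      then show "u = v" using z by (simp add: y_def)
    qed
    ultimately have "norm ((deriv ^^ 2) ?g 0) \<le> K0 * norm ((deriv ^^ 1) ?g 0)"
      using K0 by simp
    moreover have "(deriv ^^ n) ?g 0 = y ^ n * (deriv ^^ n) f z" for n
      using higher_deriv_compose_linear'[OF hol open_ball[of 0 1] open_halfspace_Im_gt, of 0 y z n] sub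
      by simp
    ultimately have "norm (y\<^sup>2 * (deriv ^^ 2) f z) \<le> K0 * norm (y ^ 1 * (deriv ^^ 1) f z)"
      by metis
    then have "(Im z)\<^sup>2 * norm (deriv (deriv f) z) \<le> K0 * (Im z * norm (deriv f z))"
      using z by (simp add: norm_mult norm_power y_def numeral_2_eq_2)
    also have "\<dots> \<le> N * (Im z * norm (deriv f z))"
      using N z by (intro mult_right_mono) auto
    finally show ?thesis using z by (simp add: field_simps power2_eq_square)
  qed
  have "contractible ?H"
    by (simp add: convex_imp_contractible convex_halfspace_Im_gt)
  then obtain L where L: "L holomorphic_on ?H" "\<And>z. z \<in> ?H \<Longrightarrow> deriv f z = exp (L z)"
    using contractible_imp_holomorphic_log[OF holf'] nz by blast
  have L': "norm (deriv L z) \<le> N / Im z" if z: "Im z > 0" for z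
  proof -
    have "((\<lambda>w. exp (L w)) has_field_derivative exp (L z) * deriv L z) (at z)"
      using holomorphic_derivI[OF L(1) open_halfspace_Im_gt] z by (auto intro!: derivative_eq_intros)
    then have "(deriv f has_field_derivative exp (L z) * deriv L z) (at z)"
      by (rule has_field_derivative_transform_within_open[OF _ open_halfspace_Im_gt[of 0]])
         (use z L(2) in auto)
    then have "deriv (deriv f) z = deriv f z * deriv L z"
      using L(2) z by (simp add: DERIV_imp_deriv)
    then have "norm (deriv L z) * norm (deriv f z) \<le> N / Im z * norm (deriv f z)"
      using pre_schwarzian[OF z] by (simp add: norm_mult mult.commute)
    then show ?thesis using nz[OF z] by (subst (asm) mult_le_cancel_right_pos) auto
  qed
  define C where "C = exp (norm (L \<i>) + N)"
  \<comment> \<open>As \<open>norm (deriv f z) = exp (Re (L z))\<close>, bounding the absolute value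
    of \<open>Re (L z)\<close> handles \<open>deriv f\<close> and its reciprocal together.\<close>
  have growth: "exp \<bar>Re (L z)\<bar> \<le> C * ((1 + norm z)\<^sup>2 / Im z) ^ N" if z: "Im z > 0" for z
  proof -
    let ?A = "(1 + norm z)\<^sup>2 / Im z"
    have A: "?A > 0" using z add_pos_nonneg[OF zero_less_one norm_ge_zero[of z]] by simp
    have "\<bar>Re (L z)\<bar> \<le> norm (L \<i>) + norm (L z - L \<i>)"
      using abs_Re_le_cmod[of "L z"] norm_triangle_sub[of "L z" "L \<i>"] by linarith
    also have "\<dots> \<le> norm (L \<i>) + N * (1 + ln ?A)"
      using half_plane_log_growth[OF L(1) L' z] by simp
    finally have "exp \<bar>Re (L z)\<bar> \<le> exp (norm (L \<i>) + N + N * ln ?A)"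
      by (simp add: algebra_simps)
    also have "\<dots> = C * ?A ^ N"
      using A by (simp add: C_def exp_add exp_of_nat_mult)
    finally show ?thesis .
  qed
  show ?thesis
  proof (rule that[of C N])
    fix z assume z: "Im z > 0"
    have "norm (deriv f z) = exp (Re (L z))" using L(2) z by simp
    also have "\<dots> \<le> exp \<bar>Re (L z)\<bar>" by simp
    finally show "norm (deriv f z) \<le> C * ((1 + norm z)\<^sup>2 / Im z) ^ N"
      using growth[OF z] by linarith
    have "norm (inverse (deriv f z)) = exp (- Re (L z))"
      using L(2) z by (simp add: norm_inverse exp_minus)
    also have "\<dots> \<le> exp \<bar>Re (L z)\<bar>" by simp
    finally show "norm (inverse (deriv f z)) \<le> C * ((1 + norm z)\<^sup>2 / Im z) ^ N"
      using growth[OF z] by linarith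
  qed
qed

section \<open>Maximum modulus and Phragmen-Lindelof principles in the half-plane\<close>

text \<open>The frontier of the closed half-disc is a real segment together with an arc. The corners
  belong to the segment, so the arc needs control only where \<open>Im z > 0\<close>, the region
  where the growth bounds make sense.\<close>

lemma half_disc_maximum_modulus:
  assumes hol: "G holomorphic_on {z. Im z > 0}" and cont: "continuous_on {z. Im z \<ge> 0} G"
    and real: "\<And>x. \<bar>x\<bar> \<le> R \<Longrightarrow> norm (G (of_real x)) \<le> B"
    and circ: "\<And>z. Im z > 0 \<Longrightarrow> norm z = R \<Longrightarrow> norm (G z) \<le> B"
    and z: "Im z \<ge> 0" "norm z \<le> R"
  shows "norm (G z) \<le> B"
proof -
  let ?S = "cball 0 R \<inter> {z. Im z \<ge> 0}"
  have int: "interior ?S = ball 0 R \<inter> {z. Im z > 0}"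
    using interior_halfspace_ge[of \<i> 0] by (simp add: interior_Int)
  have cl: "closed ?S" by (intro closed_Int closed_cball closed_halfspace_Im_ge)
  show ?thesis
  proof (rule maximum_modulus_frontier[of G ?S])
    show "G holomorphic_on interior ?S"
      unfolding int using hol by (rule holomorphic_on_subset) auto
    show "continuous_on (closure ?S) G"
      using cont cl by (auto intro: continuous_on_subset)
    show "bounded ?S" by (simp add: bounded_Int)
    have fr: "frontier ?S = ?S - ball 0 R \<inter> {z. Im z > 0}"
      by (simp only: frontier_def closure_closed[OF cl] int)
    fix w assume "w \<in> frontier ?S"
    then have w: "norm w \<le> R" "Im w \<ge> 0" "\<not> (norm w < R \<and> Im w > 0)"
      unfolding fr by auto
    show "norm (G w) \<le> B"
    proof (cases "Im w = 0")
      case True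
      then have "w = of_real (Re w)" by (simp add: complex_eq_iff)
      then show ?thesis using real[of "Re w"] w(1) abs_Re_le_cmod[of w] by simp
    next
      case False
      then show ?thesis using circ w by simp
    qed
  qed (use z in auto)
qed

text \<open>On \<open>|z| = R\<close> the factor \<open>1 - z\<^sup>2 / R\<^sup>2\<close> has modulus \<open>2 Im z / R\<close>, so its \<open>N\<close>-th power
  cancels the singularity of the bound at the real axis.\<close>

lemma half_plane_polynomial_growth:
  fixes F :: "complex \<Rightarrow> complex"
  assumes hol: "F holomorphic_on {z. Im z > 0}" and cont: "continuous_on {z. Im z \<ge> 0} F"
    and real: "\<And>x. norm (F (of_real x)) \<le> c"
    and growth: "\<And>z. Im z > 0 \<Longrightarrow> norm (F z) \<le> C * ((1 + norm z)\<^sup>2 / Im z) ^ N"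
  obtains M where "\<And>z. Im z \<ge> 0 \<Longrightarrow> norm (F z) \<le> M * (1 + norm z) ^ (2 * N)"
proof (rule that)
  fix z :: complex assume z: "Im z \<ge> 0"
  have c: "c \<ge> 0" using order_trans[OF norm_ge_zero real[of 0]] .
  have "0 \<le> C * ((1 + norm \<i>)\<^sup>2 / Im \<i>) ^ N"
    by (rule order_trans[OF norm_ge_zero growth]) simp
  then have C: "C \<ge> 0" by (simp add: zero_le_mult_iff power_le_zero_eq)
  \<comment> \<open>The radius is proportional to \<open>1 + norm z\<close>, which keeps the final
    bound polynomial. It also puts \<open>z\<close> within half the radius, where the factor
    \<open>P\<close> is bounded away from 0.\<close>
  define R where "R = 2 * (1 + norm z)"
  have R: "R \<ge> 2" "norm z \<le> R" "norm z \<le> R / 2" by (auto simp: R_def)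
  define P where "P w = (1 - w\<^sup>2 / (of_real R)\<^sup>2) ^ N" for w :: complex
  define B where "B = c + C * (2 * (1 + R)\<^sup>2) ^ N"
  have "norm (F z * P z) \<le> B"
  proof (rule half_disc_maximum_modulus[of "\<lambda>z. F z * P z" R])
    show "(\<lambda>z. F z * P z) holomorphic_on {z. 0 < Im z}"
      unfolding P_def using R(1) by (intro holomorphic_intros hol) auto
    show "continuous_on {z. 0 \<le> Im z} (\<lambda>z. F z * P z)"
      unfolding P_def using R(1) by (intro continuous_intros cont) auto
  next
    fix x :: real assume x: "\<bar>x\<bar> \<le> R"
    have "x\<^sup>2 \<le> R\<^sup>2" using power_mono[OF x, of 2] by simp
    then have "0 \<le> 1 - x\<^sup>2 / R\<^sup>2" "1 - x\<^sup>2 / R\<^sup>2 \<le> 1" using R(1) by (auto simp: divide_le_eq)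
    moreover have "norm (P (of_real x)) = norm (complex_of_real (1 - x\<^sup>2 / R\<^sup>2)) ^ N"
      by (simp add: P_def norm_power)
    ultimately have "norm (P (of_real x)) \<le> 1"
      unfolding norm_of_real by (simp add: power_le_one)
    then have "norm (F (of_real x)) * norm (P (of_real x)) \<le> c * 1"
      using real c by (intro mult_mono) auto
    also have "\<dots> \<le> B" using C R(1) by (simp add: B_def)
    finally show "norm (F (of_real x) * P (of_real x)) \<le> B" by (simp add: norm_mult)
  next
    fix w :: complex assume w: "Im w > 0" "norm w = R"
    have "(of_real R)\<^sup>2 - w\<^sup>2 = w * (cnj w - w)"
      using w(2) complex_norm_square[of w] by (simp add: algebra_simps power2_eq_square)
    also have "norm \<dots> = R * (2 * Im w)"
      using w complex_diff_cnj[of w] by (simp add: norm_mult norm_minus_commute[of "cnj w"])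
    finally have "norm (1 - w\<^sup>2 / (of_real R)\<^sup>2) = R * (2 * Im w) / R\<^sup>2"
      using R(1) by (subst diff_divide_eq_iff) (auto simp: norm_divide norm_power)
    then have "norm (P w) = (2 * Im w / R) ^ N"
      using R(1) by (simp add: P_def norm_power power2_eq_square)
    then have "norm (F w * P w) \<le> C * ((1 + R)\<^sup>2 / Im w) ^ N * (2 * Im w / R) ^ N"
      using growth[OF w(1)] w R(1) by (simp add: norm_mult mult_right_mono)
    also have "\<dots> = C * (2 * (1 + R)\<^sup>2 / R) ^ N"
      using w(1) by (simp add: mult.commute flip: power_mult_distrib)
    also have "\<dots> \<le> C * (2 * (1 + R)\<^sup>2) ^ N"
    proof -
      have "2 * (1 + R)\<^sup>2 / R \<le> 2 * (1 + R)\<^sup>2 / 1"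
        using R(1) by (intro divide_left_mono) auto
      then show ?thesis using C R(1) by (intro mult_left_mono power_mono) auto
    qed
    also have "\<dots> \<le> B" using c by (simp add: B_def)
    finally show "norm (F w * P w) \<le> B" .
  qed (use z R in auto)
  moreover have "norm (P z) \<ge> (1/2) ^ N"
  proof -
    have "norm z / R \<le> 1/2" using R by (simp add: field_simps)
    then have "(norm z / R)\<^sup>2 \<le> (1/2)\<^sup>2" using R by (intro power_mono) auto
    then have "norm (z\<^sup>2 / (of_real R)\<^sup>2) \<le> 1/4"
      using R(1) by (simp add: norm_divide norm_power power_divide)
    then have "norm (1 - z\<^sup>2 / (of_real R)\<^sup>2) \<ge> 1/2"
      using norm_triangle_ineq2[of 1 "z\<^sup>2 / (of_real R)\<^sup>2"] by simp
    then show ?thesis by (simp add: P_def norm_power power_mono)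
  qed
  ultimately have "norm (F z) * (1/2) ^ N \<le> B"
    by (metis mult_left_mono norm_ge_zero norm_mult order_trans)
  then have "norm (F z) \<le> 2 ^ N * B"
    by (simp add: field_simps)
  \<comment> \<open>Here \<open>1 + R \<le> 3 * (1 + norm z)\<close>; the 18 below is
    \<open>2 * 3^2\<close>.\<close>
  also have "B \<le> c * (1 + norm z) ^ (2 * N) + C * (2 * (3 * (1 + norm z))\<^sup>2) ^ N"
    unfolding B_def
  proof (intro add_mono mult_left_mono power_mono)
    show "c \<le> c * (1 + norm z) ^ (2 * N)"
      using mult_left_mono[OF one_le_power[of "1 + norm z" "2 * N"] c] by simp
  qed (use R C in \<open>auto simp: R_def\<close>)
  also have "\<dots> = (c + C * 18 ^ N) * (1 + norm z) ^ (2 * N)"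
  proof -
    have "2 * (3 * (1 + norm z))\<^sup>2 = 18 * (1 + norm z)\<^sup>2"
      unfolding power_mult_distrib by simp
    then show ?thesis by (simp only: power_mult_distrib power_mult distrib_right mult.assoc)
  qed
  finally show "norm (F z) \<le> (2 ^ N * (c + C * 18 ^ N)) * (1 + norm z) ^ (2 * N)"
    by simp
qed

text \<open>The function is damped by \<open>exp (- \<epsilon> * csqrt (1 - \<i> * z))\<close>. On
  the closed half-plane \<open>1 - \<i> * z\<close> has real part at least 1, so the principal root
  is holomorphic there, and its real part grows like the square root of \<open>norm z\<close>, which
  beats any polynomial. Large half-discs give the bound for each \<open>\<epsilon>\<close>, and then
  \<open>\<epsilon>\<close> tends to 0.\<close>

lemma half_plane_Phragmen_Lindelof:
  fixes F :: "complex \<Rightarrow> complex"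
  assumes hol: "F holomorphic_on {z. Im z > 0}" and cont: "continuous_on {z. Im z \<ge> 0} F"
    and c: "c > 0" and real: "\<And>x. norm (F (of_real x)) \<le> c"
    and growth: "\<And>z. Im z \<ge> 0 \<Longrightarrow> norm (F z) \<le> M * (1 + norm z) ^ n"
    and z: "Im z \<ge> 0"
  shows "norm (F z) \<le> c"
proof -
  define s where "s w = csqrt (1 - \<i> * w)" for w
  have pos: "1 - \<i> * w \<notin> \<real>\<^sub>\<le>\<^sub>0" if "Im w \<ge> 0" for w
    using that by (auto simp: complex_nonpos_Reals_iff)
  have hols: "s holomorphic_on {w. Im w \<ge> 0}"
    unfolding s_def by (intro holomorphic_intros) (use pos in auto)
  then have hols': "s holomorphic_on {w. Im w > 0}"
    by (rule holomorphic_on_subset) auto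
  have damped: "norm (F z) * exp (- \<epsilon> * Re (s z)) \<le> c" if \<epsilon>: "\<epsilon> > 0" for \<epsilon> :: real
  proof -
    have "((\<lambda>R. M * (1 + R) ^ n * exp (- \<epsilon> * sqrt ((R - 1) / 2))) \<longlongrightarrow> 0) at_top"
      using \<epsilon> by real_asymp
    then have "\<forall>\<^sub>F R in at_top. M * (1 + R) ^ n * exp (- \<epsilon> * sqrt ((R - 1) / 2)) < c"
      using c by (rule order_tendstoD)
    then obtain R where R: "R \<ge> norm z"
        "M * (1 + R) ^ n * exp (- \<epsilon> * sqrt ((R - 1) / 2)) \<le> c"
      by (smt (verit, best) eventually_at_top_linorder)
    have nrm: "norm (exp (- of_real \<epsilon> * s w)) = exp (- \<epsilon> * Re (s w))" for w
      by simp
    have "norm (F z * exp (- of_real \<epsilon> * s z)) \<le> c"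
    proof (rule half_disc_maximum_modulus[of "\<lambda>w. F w * exp (- of_real \<epsilon> * s w)" R])
      show "(\<lambda>w. F w * exp (- of_real \<epsilon> * s w)) holomorphic_on {z. 0 < Im z}"
        by (intro holomorphic_intros hol hols')
      show "continuous_on {z. 0 \<le> Im z} (\<lambda>w. F w * exp (- of_real \<epsilon> * s w))"
        by (intro continuous_intros cont holomorphic_on_imp_continuous_on[OF hols])
    next
      fix x :: real
      have "exp (- \<epsilon> * Re (s (of_real x))) \<le> 1"
        using \<epsilon> Re_csqrt by (simp add: s_def del: csqrt.sel)
      then have "norm (F (of_real x)) * exp (- \<epsilon> * Re (s (of_real x))) \<le> c * 1"
        using real c by (intro mult_mono) auto
      then show "norm (F (of_real x) * exp (- of_real \<epsilon> * s (of_real x))) \<le> c"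
        by (simp only: norm_mult nrm)
    next
      fix w assume w: "Im w > 0" "norm w = R"
      have "R \<le> norm (1 - \<i> * w) + 1"
        using norm_triangle_ineq2[of "\<i> * w" 1] w(2) by (simp add: norm_mult norm_minus_commute)
      \<comment> \<open>The real part of \<open>csqrt v\<close> is
        \<open>sqrt ((norm v + Re v) / 2)\<close>; here \<open>norm v \<ge> R - 1\<close> and
        \<open>Re v = 1 + Im w\<close> is positive.\<close>
      then have "sqrt ((R - 1) / 2) \<le> Re (s w)"
        unfolding s_def csqrt.sel using w(1) by (intro real_sqrt_le_mono) auto
      then have "exp (- \<epsilon> * Re (s w)) \<le> exp (- \<epsilon> * sqrt ((R - 1) / 2))"
        using \<epsilon> by simp
      then have "norm (F w) * exp (- \<epsilon> * Re (s w)) \<le>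
          M * (1 + R) ^ n * exp (- \<epsilon> * sqrt ((R - 1) / 2))"
        using growth[of w] w by (intro mult_mono) (auto intro: order_trans[OF norm_ge_zero])
      then show "norm (F w * exp (- of_real \<epsilon> * s w)) \<le> c"
        unfolding norm_mult nrm using R(2) by linarith
    qed (use z R in auto)
    then show ?thesis by (simp only: norm_mult nrm)
  qed
  have "((\<lambda>\<epsilon>. norm (F z) * exp (- \<epsilon> * Re (s z))) \<longlongrightarrow> norm (F z) * exp (- 0 * Re (s z))) (at_right 0)"
    by (intro tendsto_intros)
  moreover have "\<forall>\<^sub>F \<epsilon> in at_right 0. norm (F z) * exp (- \<epsilon> * Re (s z)) \<le> c"
    using damped by (auto simp: eventually_at_filter)
  ultimately show ?thesis
    using tendsto_upperbound[of "\<lambda>\<epsilon>. norm (F z) * exp (- \<epsilon> * Re (s z))" _ "at_right 0" c] by simp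
qed

theorem mainTheorem12:
  fixes f :: "complex \<Rightarrow> complex" and D :: "complex \<Rightarrow> (complex \<Rightarrow>\<^sub>L complex)" and c :: real
  assumes hol: "f holomorphic_on upper_half_plane"
    and inj: "inj_on f upper_half_plane"
    and C1: "C1_on_closed_half_plane f D"
    and cpos: "c > 0"
  shows "((\<forall>x::real. norm (D (complex_of_real x) 1) \<le> c) \<longrightarrow>
            (\<forall>z\<in>upper_half_plane. norm (deriv f z) \<le> c))
       \<and> ((\<forall>x::real. norm (D (complex_of_real x) 1) \<ge> c) \<longrightarrow>
            (\<forall>z\<in>upper_half_plane. norm (deriv f z) \<ge> c))
       \<and> ((\<exists>a. \<forall>x::real. norm (D (complex_of_real x) 1) = a) \<longrightarrow>
            (\<exists>k. \<forall>z\<in>upper_half_plane. deriv f z = k))"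
proof -
  \<comment> \<open>\<open>F\<close> is the continuous extension of \<open>deriv f\<close> to the
    closed half-plane. On the real axis \<open>deriv f\<close> itself would depend on the values of
    \<open>f\<close> below the axis.\<close>
  define F where "F z = blinfun_apply (D z) 1" for z
  have C1': "(f has_derivative blinfun_apply (D z)) (at z within {z. Im z \<ge> 0})" if "Im z \<ge> 0" for z
    using C1 that by (simp add: C1_on_closed_half_plane_def closed_upper_half_plane_def)
  have "continuous_on {z. Im z \<ge> 0} D"
    using C1 by (simp add: C1_on_closed_half_plane_def closed_upper_half_plane_def)
  then have contF: "continuous_on {z. Im z \<ge> 0} F"
    unfolding F_def by (intro continuous_intros)
  have hol': "f holomorphic_on {z. Im z > 0}" and inj': "inj_on f {z. Im z > 0}"
    using hol inj by (simp_all add: upper_half_plane_def)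
  have derivF: "deriv f z = F z" if z: "Im z > 0" for z
  proof -
    have "(f has_derivative blinfun_apply (D z)) (at z within {z. Im z > 0})"
      using C1'[of z] z by (auto intro: has_derivative_subset)
    then have "(f has_derivative blinfun_apply (D z)) (at z)"
      using z by (simp add: at_within_open[OF _ open_halfspace_Im_gt])
    moreover have "(f has_derivative (*) (deriv f z)) (at z)"
      using holomorphic_derivI[OF hol' open_halfspace_Im_gt] z
      by (simp add: has_field_derivative_def)
    ultimately have "blinfun_apply (D z) = (*) (deriv f z)"
      by (rule has_derivative_unique)
    then show ?thesis by (simp add: F_def)
  qed
  have nz: "F z \<noteq> 0" if "Im z > 0" for z
    using holomorphic_injective_imp_regular[OF hol' open_halfspace_Im_gt inj'] derivF that by simp
  have holF: "F holomorphic_on {z. Im z > 0}"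
    using holomorphic_deriv[OF hol' open_halfspace_Im_gt] derivF
    by (auto intro: holomorphic_transform)
  obtain C N where growth:
      "\<And>z. Im z > 0 \<Longrightarrow> norm (F z) \<le> C * ((1 + norm z)\<^sup>2 / Im z) ^ N"
      "\<And>z. Im z > 0 \<Longrightarrow> norm (inverse (F z)) \<le> C * ((1 + norm z)\<^sup>2 / Im z) ^ N"
    using univalent_half_plane_derivative_growth[OF hol' inj'] derivF by metis
  \<comment> \<open>Stated for a general \<open>G\<close> so that it serves both \<open>F\<close>
    and its reciprocal. The bound on the axis is used twice: first to obtain polynomial growth, then
    in the Phragmen-Lindelof step.\<close>
  have maximum: "norm (G z) \<le> b"
    if G: "G holomorphic_on {z. Im z > 0}" "continuous_on {z. Im z \<ge> 0} G"
      "\<And>z. Im z > 0 \<Longrightarrow> norm (G z) \<le> C * ((1 + norm z)\<^sup>2 / Im z) ^ N"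
      and b: "b > 0" "\<And>x. norm (G (of_real x)) \<le> b" and z: "Im z > 0" for G b z
  proof -
    obtain M where "\<And>w. Im w \<ge> 0 \<Longrightarrow> norm (G w) \<le> M * (1 + norm w) ^ (2 * N)"
      using half_plane_polynomial_growth[OF G(1,2) b(2) G(3)] by blast
    then show ?thesis
      using half_plane_Phragmen_Lindelof[OF G(1,2) b, of M "2 * N" z] z by simp
  qed
  have upper: "norm (F z) \<le> b" if "b > 0" "\<And>x. norm (F (of_real x)) \<le> b" "Im z > 0" for b z
    using maximum[OF holF contF growth(1) that] .
  have lower: "norm (F z) \<ge> b" if b: "b > 0" "\<And>x. norm (F (of_real x)) \<ge> b" and z: "Im z > 0" for b z
  proof -
    \<comment> \<open>Univalence excludes zeros only in the open half-plane; on the axis the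
      positive lower bound does so, which makes \<open>inverse (F z)\<close> continuous up to the
      boundary.\<close>
    have nz': "F w \<noteq> 0" if w: "Im w \<ge> 0" for w
    proof (cases "Im w = 0")
      case True
      then have "w = of_real (Re w)" by (simp add: complex_eq_iff)
      then show ?thesis using b(2)[of "Re w"] b(1) by auto
    qed (use nz w in simp)
    have "norm (inverse (F z)) \<le> inverse b"
    proof (rule maximum[OF _ _ growth(2)])
      show "(\<lambda>z. inverse (F z)) holomorphic_on {z. Im z > 0}"
        using nz by (intro holomorphic_intros holF) auto
      show "continuous_on {z. Im z \<ge> 0} (\<lambda>z. inverse (F z))"
        using nz' by (intro continuous_intros contF) auto
      show "norm (inverse (F (of_real x))) \<le> inverse b" for x
        unfolding norm_inverse using b by (intro le_imp_inverse_le)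
    qed (use b z in auto)
    then show ?thesis using nz[OF z] b(1) by (simp add: norm_inverse)
  qed
  have const: "\<exists>k. \<forall>z. Im z > 0 \<longrightarrow> F z = k" if a: "\<And>x. norm (F (of_real x)) = a" for a
  proof -
    \<comment> \<open>If \<open>F\<close> vanished on the axis, every positive \<open>b\<close>
      would be admissible in \<open>upper\<close>; taking half of \<open>norm (F \<i>)\<close>
      contradicts \<open>F \<i> \<noteq> 0\<close>.\<close>
    have "a > 0"
    proof (rule ccontr)
      assume "\<not> a > 0"
      then have "norm (F (of_real x)) \<le> norm (F \<i>) / 2" for x
        unfolding a by (rule order_trans[of _ 0, OF leI]) simp
      then have "norm (F \<i>) \<le> norm (F \<i>) / 2"
        using nz[of \<i>] upper[of "norm (F \<i>) / 2" \<i>] by simp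
      then show False using nz[of \<i>] by simp
    qed
    then have "norm (F z) = a" if "Im z > 0" for z
      using upper[of a z] lower[of a z] a that by (simp add: order.antisym)
    \<comment> \<open>Since \<open>norm (F z)\<close> is constant, it attains its maximum at the
      interior point \<open>\<i>\<close>.\<close>
    then have "F constant_on {z. Im z > 0}"
      by (intro maximum_modulus_principle[OF holF, of "{z. Im z > 0}" \<i>])
         (auto simp: open_halfspace_Im_gt convex_connected convex_halfspace_Im_gt)
    then show ?thesis by (auto simp: constant_on_def)
  qed
  have "norm (F z) \<le> c" if "\<forall>x::real. norm (F (of_real x)) \<le> c" "Im z > 0" for z
    using upper[OF cpos _ that(2)] that(1) by blast
  moreover have "norm (F z) \<ge> c" if "\<forall>x::real. norm (F (of_real x)) \<ge> c" "Im z > 0" for z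
    using lower[OF cpos _ that(2)] that(1) by blast
  moreover have "\<exists>k. \<forall>z. Im z > 0 \<longrightarrow> F z = k" if "\<exists>a. \<forall>x::real. norm (F (of_real x)) = a"
    using const that by blast
  ultimately show ?thesis
    unfolding upper_half_plane_def by (simp add: derivF flip: F_def)
qed

end
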